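(* Let $X$ be a random variable with values in $\mathbb{R}^d$ ($d\ge 1$) and $S$ a random variable with values in $\{0,1\}$, defined on a common probability space, with $\mathbb{P}(S=0)>0$ and $\mathbb{P}(S=1)>0$. Let $g:\mathbb{R}^d\to\{0,1\}$ be a measurable binary classifier such that $a(g):=\mathbb{P}(g(X)=1\mid S=0)>0$ and $b(g):=\mathbb{P}(g(X)=1\mid S=1)>0$, and let $\tau\in(0,1]$. Then $g$ has Disparate Impact at level $\tau$ with respect to $(X,S)$ if and only if $$BER(g,X,S)\le \frac12-\frac{a(g)}{2}\left(\frac1\tau-1\right).$$
   Context: The Disparate Impact of $g$ with respect to $(X,S)$ is $$DI(g,X,S)=\frac{\mathbb{P}(g(X)=1\mid S=0)}{\mathbb{P}(g(X)=1\mid S=1)}.$$ The classifier $g$ is said to have Disparate Impact at level $\tau\in(0,1]$ with respect to $(X,S)$ if $DI(g,X,S)\le\tau$. The Balanced Error Rate of $g$ with respect to $(X,S)$ is $$BER(g,X,S)=\frac{\mathbb{P}(g(X)=0\mid S=1)+\mathbb{P}(g(X)=1\mid S=0)}{2}.$$ *)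

theory Defs
  imports "HOL-Probability.Probability"
begin

definition disparate_impact ::
  "'w measure \<Rightarrow> ('x \<Rightarrow> nat) \<Rightarrow> ('w \<Rightarrow> 'x) \<Rightarrow> ('w \<Rightarrow> nat) \<Rightarrow> real" where
  "disparate_impact M g X S =
     \<P>(\<omega> in M. g (X \<omega>) = 1 \<bar> S \<omega> = 0) / \<P>(\<omega> in M. g (X \<omega>) = 1 \<bar> S \<omega> = 1)"

definition has_disparate_impact_at ::
  "'w measure \<Rightarrow> real \<Rightarrow> ('x \<Rightarrow> nat) \<Rightarrow> ('w \<Rightarrow> 'x) \<Rightarrow> ('w \<Rightarrow> nat) \<Rightarrow> bool" where
  "has_disparate_impact_at M \<tau> g X S \<longleftrightarrow> disparate_impact M g X S \<le> \<tau>"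

definition balanced_error_rate ::
  "'w measure \<Rightarrow> ('x \<Rightarrow> nat) \<Rightarrow> ('w \<Rightarrow> 'x) \<Rightarrow> ('w \<Rightarrow> nat) \<Rightarrow> real" where
  "balanced_error_rate M g X S =
     (\<P>(\<omega> in M. g (X \<omega>) = 0 \<bar> S \<omega> = 1) + \<P>(\<omega> in M. g (X \<omega>) = 1 \<bar> S \<omega> = 0)) / 2"

end

theory Submission
  imports Defs
begin

text \<open>Write a and b for the conditional probabilities of g(X) = 1 given S = 0 and S = 1. Since
  g is binary, P(g(X) = 0 | S = 1) = 1 - b, which is \<open>cond_prob_binary_compl\<close>, so the
  balanced error rate is (1 - b + a) / 2. Both sides of the equivalence then reduce to the same
  linear inequality a / \<tau> \<le> b.\<close>

lemma (in prob_space) cond_prob_binary_compl: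
  fixes Y :: "'a \<Rightarrow> nat" and S :: "'a \<Rightarrow> 'b"
  assumes Y: "Y \<in> M \<rightarrow>\<^sub>M count_space {0, 1}"
    and S: "{\<omega> \<in> space M. S \<omega> = s} \<in> events"
    and pos: "\<P>(\<omega> in M. S \<omega> = s) > 0"
  shows "\<P>(\<omega> in M. Y \<omega> = 0 \<bar> S \<omega> = s) = 1 - \<P>(\<omega> in M. Y \<omega> = 1 \<bar> S \<omega> = s)"
proof -
  have meas: "{\<omega> \<in> space M. Y \<omega> = y \<and> S \<omega> = s} \<in> events" if "y \<in> {0, 1}" for y
  proof -
    have "Y -` {y} \<inter> space M \<in> events"
      using measurable_sets[OF Y, of "{y}"] that by auto
    from sets.Int[OF this S] show ?thesis
      by (rule back_subst[of "\<lambda>A. A \<in> events"]) auto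
  qed
  \<comment> \<open>The type of \<open>Y\<close> allows any natural number; that only 0 and 1 occur
    comes from the target space in \<open>Y\<close>.\<close>
  have binary: "Y \<omega> \<in> {0, 1}" if "\<omega> \<in> space M" for \<omega>
    using measurable_space[OF Y that] by simp
  have "{\<omega> \<in> space M. S \<omega> = s} =
      {\<omega> \<in> space M. Y \<omega> = 0 \<and> S \<omega> = s} \<union> {\<omega> \<in> space M. Y \<omega> = 1 \<and> S \<omega> = s}"
    using binary by auto
  then have "\<P>(\<omega> in M. S \<omega> = s) =
      \<P>(\<omega> in M. Y \<omega> = 0 \<and> S \<omega> = s) + \<P>(\<omega> in M. Y \<omega> = 1 \<and> S \<omega> = s)"
    using finite_measure_Union[OF meas[of 0] meas[of 1]] by (simp add: disjoint_iff)
  \<comment> \<open>Divide the identity by P(S = s). Were this probability 0, division by zero would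
    make both conditional probabilities 0, and the claim would read 0 = 1.\<close>
  with pos show ?thesis
    by (simp add: cond_prob_def field_simps)
qed

theorem theorem2p1:
  fixes M :: "'w measure"
    and X :: "'w \<Rightarrow> real ^ 'd"
    and S :: "'w \<Rightarrow> nat"
    and g :: "real ^ 'd \<Rightarrow> nat"
    and \<tau> :: real
  assumes "prob_space M"
    and "X \<in> M \<rightarrow>\<^sub>M borel"
    and "S \<in> M \<rightarrow>\<^sub>M count_space {0, 1}"
    and "\<P>(\<omega> in M. S \<omega> = 0) > 0"
    and "\<P>(\<omega> in M. S \<omega> = 1) > 0"
    and "g \<in> borel \<rightarrow>\<^sub>M count_space {0, 1}"
    and "\<P>(\<omega> in M. g (X \<omega>) = 1 \<bar> S \<omega> = 0) > 0"
    and "\<P>(\<omega> in M. g (X \<omega>) = 1 \<bar> S \<omega> = 1) > 0"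
    and "0 < \<tau>" and "\<tau> \<le> 1"
  shows "has_disparate_impact_at M \<tau> g X S \<longleftrightarrow>
    balanced_error_rate M g X S
      \<le> 1 / 2 - \<P>(\<omega> in M. g (X \<omega>) = 1 \<bar> S \<omega> = 0) / 2 * (1 / \<tau> - 1)"
proof -
  interpret prob_space M by fact
  let ?a = "\<P>(\<omega> in M. g (X \<omega>) = 1 \<bar> S \<omega> = 0)"
  let ?b = "\<P>(\<omega> in M. g (X \<omega>) = 1 \<bar> S \<omega> = 1)"
  have "(\<lambda>\<omega>. g (X \<omega>)) \<in> M \<rightarrow>\<^sub>M count_space {0, 1}"
    using measurable_compose assms(2,6) .
  moreover have "{\<omega> \<in> space M. S \<omega> = 1} \<in> events"
    using measurable_sets[OF assms(3), of "{1}"] by (simp add: vimage_def Int_def conj_commute)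
  \<comment> \<open>The complement rule, with s = 1, is applied to the composite of \<open>g\<close>
    and \<open>X\<close>; the term for S = 0 is already a.\<close>
  ultimately have "balanced_error_rate M g X S = (1 - ?b + ?a) / 2"
    using assms(5) by (simp add: balanced_error_rate_def cond_prob_binary_compl)
  \<comment> \<open>As b and \<tau> are positive, a / b \<le> \<tau> can be multiplied by b and
    divided by \<tau> without reversing the inequality.\<close>
  moreover have "has_disparate_impact_at M \<tau> g X S \<longleftrightarrow> ?a / \<tau> \<le> ?b"
    using assms(8,9)
    by (simp add: has_disparate_impact_at_def disparate_impact_def field_simps)
  \<comment> \<open>The bound equals 1/2 + a/2 - a/(2 \<tau>), so 1/2 + a/2 cancels against the
    error rate and leaves a / \<tau> \<le> b.\<close>
  ultimately show ?thesis
    by (auto simp: field_simps)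
qed

end
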